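(* For every integer $n$ and every $d=d(n)$ with $1<d\le n/2$, $\mathsf{OBDD^{d-1}}\subsetneq\mathsf{OBDD^{d}}$ and $\mathsf{NOBDD^{d-1}}\subsetneq\mathsf{NOBDD^{d}}$.
   Context: $\mathsf{OBDD^d}$ (resp. $\mathsf{NOBDD^d}$) denotes the set of Boolean functions $f:\{0,1\}^n\to\{0,1\}$ that can be computed by a deterministic (resp. nondeterministic) OBDD of width $d$ (i.e. at most $d$ nodes in every level), where $n$ is the number of variables. A deterministic OBDD on $x_1,\dots,x_n$ with order $\pi$ (a permutation of $\{1,\dots,n\}$) is a leveled directed acyclic graph with levels $0,\dots,n$, a single source at level $0$, every node at level $j-1$ having exactly one outgoing edge labelled $0$ and one labelled $1$ to nodes at level $j$, and nodes at level $n$ marked accepting or rejecting; on input $\nu$ one follows from the source at step $j$ the edge labelled $\nu_{\pi(j)}$ and outputs $1$ iff an accepting node is reached. A nondeterministic OBDD is the same except that each node may have any number of outgoing edges with each label, and the output is $1$ iff some path consistent with $\nu$ reaches an accepting node. Width is the maximum number of nodes in a level. *)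

theory Defs
  imports Complex_Main "HOL-Library.FuncSet" "HOL-Combinatorics.Permutations"
begin

text \<open>The cube \<open>{0,1}^n\<close>: assignments to the variables \<open>x\<^sub>1, \<dots>, x\<^sub>n\<close>. Assignments and
  Boolean functions are extensional, so that equality of functions is equality on their domains.\<close>

definition cube :: "nat \<Rightarrow> (nat \<Rightarrow> bool) set" where
  "cube n = {1..n} \<rightarrow>\<^sub>E UNIV"

definition boolean_functions :: "nat \<Rightarrow> ((nat \<Rightarrow> bool) \<Rightarrow> bool) set" where
  "boolean_functions n = cube n \<rightarrow>\<^sub>E UNIV"

text \<open>An edge \<open>(u, b, v)\<close> leads from \<open>u\<close> to \<open>v\<close> and is labelled \<open>b\<close>.\<close>

record 'v bdd =
  var_order :: "nat \<Rightarrow> nat"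
  level :: "nat \<Rightarrow> 'v set"
  source :: 'v
  edges :: "('v \<times> bool \<times> 'v) set"
  accepting :: "'v set"

definition is_nobdd :: "nat \<Rightarrow> 'v bdd \<Rightarrow> bool" where
  "is_nobdd n D \<longleftrightarrow>
     var_order D permutes {1..n} \<and>
     (\<forall>j\<in>{0..n}. finite (level D j)) \<and>
     (\<forall>i\<in>{0..n}. \<forall>j\<in>{0..n}. i \<noteq> j \<longrightarrow> level D i \<inter> level D j = {}) \<and>
     level D 0 = {source D} \<and>
     edges D \<subseteq> (\<Union>j\<in>{1..n}. level D (j - 1) \<times> UNIV \<times> level D j) \<and>
     accepting D \<subseteq> level D n"

definition is_obdd :: "nat \<Rightarrow> 'v bdd \<Rightarrow> bool" where
  "is_obdd n D \<longleftrightarrow>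
     is_nobdd n D \<and>
     (\<forall>j\<in>{1..n}. \<forall>u\<in>level D (j - 1). \<forall>b. \<exists>!v. (u, b, v) \<in> edges D)"

definition width :: "nat \<Rightarrow> 'v bdd \<Rightarrow> nat" where
  "width n D = Max ((\<lambda>j. card (level D j)) ` {0..n})"

definition consistent_path :: "nat \<Rightarrow> 'v bdd \<Rightarrow> (nat \<Rightarrow> bool) \<Rightarrow> (nat \<Rightarrow> 'v) \<Rightarrow> bool" where
  "consistent_path n D \<nu> p \<longleftrightarrow>
     p 0 = source D \<and> (\<forall>j\<in>{1..n}. (p (j - 1), \<nu> (var_order D j), p j) \<in> edges D)"

definition nobdd_accepts :: "nat \<Rightarrow> 'v bdd \<Rightarrow> (nat \<Rightarrow> bool) \<Rightarrow> bool" where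
  "nobdd_accepts n D \<nu> \<longleftrightarrow> (\<exists>p. consistent_path n D \<nu> p \<and> p n \<in> accepting D)"

text \<open>The description in \<open>obdd_run\<close> is only meaningful for deterministic diagrams and for
  at most \<open>n\<close> steps, where the successor is unique.\<close>

primrec obdd_run :: "'v bdd \<Rightarrow> (nat \<Rightarrow> bool) \<Rightarrow> nat \<Rightarrow> 'v" where
  "obdd_run D \<nu> 0 = source D"
| "obdd_run D \<nu> (Suc j) = (THE v. (obdd_run D \<nu> j, \<nu> (var_order D (Suc j)), v) \<in> edges D)"

definition obdd_accepts :: "nat \<Rightarrow> 'v bdd \<Rightarrow> (nat \<Rightarrow> bool) \<Rightarrow> bool" where
  "obdd_accepts n D \<nu> \<longleftrightarrow> obdd_run D \<nu> n \<in> accepting D"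

text \<open>The diagrams are finite, so taking nodes in \<^typ>\<open>nat\<close> is no restriction.\<close>

definition OBDD :: "nat \<Rightarrow> nat \<Rightarrow> ((nat \<Rightarrow> bool) \<Rightarrow> bool) set" where
  "OBDD n d = {f \<in> boolean_functions n.
     \<exists>D :: nat bdd. is_obdd n D \<and> width n D \<le> d \<and> (\<forall>\<nu>\<in>cube n. f \<nu> = obdd_accepts n D \<nu>)}"

definition NOBDD :: "nat \<Rightarrow> nat \<Rightarrow> ((nat \<Rightarrow> bool) \<Rightarrow> bool) set" where
  "NOBDD n d = {f \<in> boolean_functions n.
     \<exists>D :: nat bdd. is_nobdd n D \<and> width n D \<le> d \<and> (\<forall>\<nu>\<in>cube n. f \<nu> = nobdd_accepts n D \<nu>)}"

end

theory Submission imports Defs begin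

text \<open>The separating function is \<open>MOD\<^sub>d\<close>, which tests whether the number of ones is divisible by
  \<open>d\<close>. Counting modulo \<open>d\<close> takes \<open>d\<close> nodes per level. Conversely, cut any diagram for \<open>MOD\<^sub>d\<close>
  after \<open>d - 1\<close> steps: the \<open>d\<close> inputs with \<open>i < d\<close> ones before the cut and \<open>-i mod d\<close> ones after
  it are accepted, but exchanging the tails of two of them yields a rejected input. So their
  accepting paths pass through pairwise distinct nodes at the cut, even in a nondeterministic
  diagram.\<close>

section \<open>Paths, levels, and determinism as a special case of nondeterminism\<close>

lemma is_obddD: "is_obdd n D \<Longrightarrow> is_nobdd n D"
  by (simp add: is_obdd_def)

text \<open>An edge is only known to join some consecutive pair of levels; disjointness of the
  levels forces that pair to start at \<open>j\<close>.\<close>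

lemma edge_target_level:
  assumes D: "is_nobdd n D" and e: "(u, b, v) \<in> edges D" and u: "u \<in> level D j" and j: "j < n"
  shows "v \<in> level D (Suc j)"
proof -
  obtain i where i: "i \<in> {1..n}" "u \<in> level D (i - 1)" "v \<in> level D i"
    using D e unfolding is_nobdd_def by blast
  have disj: "\<And>i j. i \<in> {0..n} \<Longrightarrow> j \<in> {0..n} \<Longrightarrow> i \<noteq> j \<Longrightarrow> level D i \<inter> level D j = {}"
    using D unfolding is_nobdd_def by blast
  have "i - 1 = j"
  proof (rule ccontr)
    assume "i - 1 \<noteq> j"
    then have "level D (i - 1) \<inter> level D j = {}" using i(1) j by (intro disj) auto
    with i(2) u show False by blast
  qed
  with i show ?thesis by auto
qed

lemma consistent_path_edge:
  assumes "consistent_path n D \<nu> p" and "j < n"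
  shows "(p j, \<nu> (var_order D (Suc j)), p (Suc j)) \<in> edges D"
proof -
  have "\<forall>j\<in>{1..n}. (p (j - 1), \<nu> (var_order D j), p j) \<in> edges D"
    using assms(1) by (simp add: consistent_path_def)
  from bspec[OF this, of "Suc j"] assms(2) show ?thesis by simp
qed

lemma consistent_path_level:
  assumes D: "is_nobdd n D" and p: "consistent_path n D \<nu> p" and "j \<le> n"
  shows "p j \<in> level D j"
  using \<open>j \<le> n\<close>
proof (induction j)
  case 0
  then show ?case using D p by (simp add: is_nobdd_def consistent_path_def)
next
  case (Suc j)
  then have "p j \<in> level D j" "j < n" by simp_all
  then show ?case using edge_target_level[OF D consistent_path_edge[OF p]] by blast
qed

text \<open>Membership in the level supplies the unique successor, so \<open>THE\<close> in
  \<open>obdd_run\<close> denotes an actual edge target.\<close>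

lemma obdd_run_step:
  assumes D: "is_obdd n D" and j: "j < n" and u: "obdd_run D \<nu> j \<in> level D j"
  shows "(obdd_run D \<nu> j, \<nu> (var_order D (Suc j)), obdd_run D \<nu> (Suc j)) \<in> edges D"
proof -
  have "\<forall>j\<in>{1..n}. \<forall>u\<in>level D (j - 1). \<forall>b. \<exists>!v. (u, b, v) \<in> edges D"
    using D by (simp add: is_obdd_def)
  from bspec[OF this, of "Suc j"] u j
  have "\<exists>!v. (obdd_run D \<nu> j, \<nu> (var_order D (Suc j)), v) \<in> edges D" by simp
  from theI'[OF this] show ?thesis by simp
qed

lemma obdd_run_level:
  assumes D: "is_obdd n D" and "j \<le> n"
  shows "obdd_run D \<nu> j \<in> level D j"
  using \<open>j \<le> n\<close>
proof (induction j)
  case 0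
  then show ?case using is_obddD[OF D] by (simp add: is_nobdd_def)
next
  case (Suc j)
  then have "j < n" "obdd_run D \<nu> j \<in> level D j" by simp_all
  then show ?case
    using edge_target_level[OF is_obddD[OF D]] obdd_run_step[OF D] by blast
qed

lemma consistent_path_obdd_run:
  assumes D: "is_obdd n D"
  shows "consistent_path n D \<nu> (obdd_run D \<nu>)"
  unfolding consistent_path_def
proof (intro conjI ballI)
  fix j assume "j \<in> {1..n}"
  then obtain i where "j = Suc i" "i < n" by (cases j) auto
  then show "(obdd_run D \<nu> (j - 1), \<nu> (var_order D j), obdd_run D \<nu> j) \<in> edges D"
    using obdd_run_step[OF D] obdd_run_level[OF D, of i] by simp
qed simp

text \<open>Besides relating the two notions of acceptance, this allows a run to be computed by
  exhibiting any consistent path.\<close>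

lemma consistent_path_unique:
  assumes D: "is_obdd n D" and p: "consistent_path n D \<nu> p" and "j \<le> n"
  shows "p j = obdd_run D \<nu> j"
  using \<open>j \<le> n\<close>
proof (induction j)
  case 0
  then show ?case using p by (simp add: consistent_path_def)
next
  case (Suc j)
  then have e: "(obdd_run D \<nu> j, \<nu> (var_order D (Suc j)), p (Suc j)) \<in> edges D"
    using consistent_path_edge[OF p, of j] by simp
  have "\<forall>j\<in>{1..n}. \<forall>u\<in>level D (j - 1). \<forall>b. \<exists>!v. (u, b, v) \<in> edges D"
    using D by (simp add: is_obdd_def)
  from bspec[OF this, of "Suc j"] Suc.prems obdd_run_level[OF D, of j]
  have "\<exists>!v. (obdd_run D \<nu> j, \<nu> (var_order D (Suc j)), v) \<in> edges D" by simp
  from the1_equality[OF this e] show ?case by simp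
qed

lemma nobdd_accepts_eq_obdd_accepts:
  assumes "is_obdd n D"
  shows "nobdd_accepts n D \<nu> = obdd_accepts n D \<nu>"
  unfolding nobdd_accepts_def obdd_accepts_def
  using consistent_path_obdd_run[OF assms] consistent_path_unique[OF assms] by (metis order_refl)

text \<open>Lets one function separate both hierarchies: a deterministic upper bound and a
  nondeterministic lower bound suffice.\<close>

lemma OBDD_subset_NOBDD: "OBDD n d \<subseteq> NOBDD n d"
  unfolding OBDD_def NOBDD_def using nobdd_accepts_eq_obdd_accepts is_obddD by blast

lemma OBDD_mono: "c \<le> d \<Longrightarrow> OBDD n c \<subseteq> OBDD n d"
  unfolding OBDD_def using order_trans by blast

lemma NOBDD_mono: "c \<le> d \<Longrightarrow> NOBDD n c \<subseteq> NOBDD n d"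
  unfolding NOBDD_def using order_trans by blast

section \<open>Upper bound: counting ones modulo \<open>d\<close> in width \<open>d\<close>\<close>

definition weight :: "nat \<Rightarrow> (nat \<Rightarrow> bool) \<Rightarrow> nat" where
  "weight n \<nu> = (\<Sum>i=1..n. of_bool (\<nu> i))"

definition MOD :: "nat \<Rightarrow> nat \<Rightarrow> (nat \<Rightarrow> bool) \<Rightarrow> bool" where
  "MOD n d = (\<lambda>\<nu>\<in>cube n. d dvd weight n \<nu>)"

lemma MOD_boolean_function: "MOD n d \<in> boolean_functions n"
  by (simp add: MOD_def boolean_functions_def)

text \<open>The node \<open>j * d + r\<close> of level \<open>j\<close> records that the weight read so far is \<open>r\<close> modulo \<open>d\<close>.\<close>

definition mod_level :: "nat \<Rightarrow> nat \<Rightarrow> nat set" where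
  "mod_level d j = (if j = 0 then {0} else {j * d..<j * d + d})"

text \<open>Since \<open>u\<close> is congruent to its recorded residue modulo \<open>d\<close>, the
  new residue is computed from \<open>u\<close> directly. The accepting node is residue 0 on the
  last level.\<close>

definition mod_bdd :: "nat \<Rightarrow> nat \<Rightarrow> nat bdd" where
  "mod_bdd n d = \<lparr>var_order = id, level = mod_level d, source = 0,
     edges = {(u, b, v). \<exists>j\<in>{1..n}. u \<in> mod_level d (j - 1) \<and> v = j * d + (u + of_bool b) mod d},
     accepting = {n * d}\<rparr>"

text \<open>A node determines its level, which yields both disjoint levels and unique
  successors.\<close>

lemma mod_level_div: "0 < d \<Longrightarrow> u \<in> mod_level d j \<Longrightarrow> u div d = j"
  by (auto simp: mod_level_def mult.commute split: if_splits intro!: div_nat_eqI)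

lemma is_obdd_mod_bdd:
  assumes d: "0 < d"
  shows "is_obdd n (mod_bdd n d)"
proof -
  have disj: "mod_level d i \<inter> mod_level d j = {}" if "i \<noteq> j" for i j
    using mod_level_div[OF d] that by blast
  have mem: "j * d + x mod d \<in> mod_level d j" if "1 \<le> j" for j x
    using that d by (simp add: mod_level_def)
  have acc: "n * d \<in> mod_level d n"
    using d by (simp add: mod_level_def)
  have fin: "finite (mod_level d j)" for j
    by (simp add: mod_level_def)
  have uniq: "i = j" if "u \<in> mod_level d (i - 1)" "u \<in> mod_level d (j - 1)" "1 \<le> i" "1 \<le> j" for u i j
    using mod_level_div[OF d that(1)] mod_level_div[OF d that(2)] that(3,4) by simp
  have "is_nobdd n (mod_bdd n d)"
    unfolding is_nobdd_def mod_bdd_def using disj mem acc fin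
    by (auto simp: permutes_id mod_level_def[of d 0])
  moreover have "\<exists>!v. (u, b, v) \<in> edges (mod_bdd n d)"
    if "j \<in> {1..n}" "u \<in> level (mod_bdd n d) (j - 1)" for j u b
  proof (rule ex1I)
    show "(u, b, j * d + (u + of_bool b) mod d) \<in> edges (mod_bdd n d)"
      using that by (auto simp: mod_bdd_def)
    show "v = j * d + (u + of_bool b) mod d" if e: "(u, b, v) \<in> edges (mod_bdd n d)" for v
    proof -
      obtain i where i: "i \<in> {1..n}" "u \<in> mod_level d (i - 1)" "v = i * d + (u + of_bool b) mod d"
        using e by (auto simp: mod_bdd_def)
      have "u \<in> mod_level d (j - 1)"
        using \<open>u \<in> level (mod_bdd n d) (j - 1)\<close> by (simp add: mod_bdd_def)
      with i uniq \<open>j \<in> {1..n}\<close> have "i = j" by simp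
      with i show ?thesis by simp
    qed
  qed
  ultimately show ?thesis by (simp add: is_obdd_def)
qed

lemma width_mod_bdd:
  assumes "0 < d"
  shows "width n (mod_bdd n d) \<le> d"
  using assms unfolding width_def by (auto simp: mod_bdd_def mod_level_def)

lemma consistent_path_mod_bdd:
  assumes d: "0 < d"
  shows "consistent_path n (mod_bdd n d) \<nu> (\<lambda>j. if j = 0 then 0 else j * d + weight j \<nu> mod d)"
proof -
  have step: "(if j = 0 then 0 else j * d + weight j \<nu> mod d, \<nu> (Suc j),
      Suc j * d + weight (Suc j) \<nu> mod d) \<in> edges (mod_bdd n d)" if "j < n" for j
  proof -
    \<comment> \<open>The offset \<open>j * d\<close> vanishes modulo \<open>d\<close>; for
      \<open>j = 0\<close> the weight is an empty sum.\<close>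
    have "weight (Suc j) \<nu> mod d
      = ((if j = 0 then 0 else j * d + weight j \<nu> mod d) + of_bool (\<nu> (Suc j))) mod d"
      by (simp add: weight_def mod_simps add.assoc)
    moreover have "(if j = 0 then 0 else j * d + weight j \<nu> mod d) \<in> mod_level d j"
      using d by (simp add: mod_level_def)
    ultimately show ?thesis
      using that unfolding mod_bdd_def by (auto intro!: bexI[of _ "Suc j"])
  qed
  then show ?thesis
    unfolding consistent_path_def
  proof (intro conjI ballI)
    fix j assume "j \<in> {1..n}"
    then obtain i where i: "j = Suc i" "i < n" by (cases j) auto
    have "var_order (mod_bdd n d) j = j" by (simp add: mod_bdd_def)
    with step[OF i(2)] i(1)
    show "(if j - 1 = 0 then 0 else (j - 1) * d + weight (j - 1) \<nu> mod d,
        \<nu> (var_order (mod_bdd n d) j), if j = 0 then 0 else j * d + weight j \<nu> mod d)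
      \<in> edges (mod_bdd n d)" by (cases "i = 0") simp_all
  qed (simp add: mod_bdd_def)
qed

lemma MOD_in_OBDD:
  assumes "0 < d" "0 < n"
  shows "MOD n d \<in> OBDD n d"
proof -
  have "obdd_run (mod_bdd n d) \<nu> n = n * d + weight n \<nu> mod d" for \<nu>
    using consistent_path_unique[OF is_obdd_mod_bdd[OF assms(1)]
        consistent_path_mod_bdd[OF assms(1)] order_refl, of n \<nu>] assms(2) by simp
  then have "obdd_accepts n (mod_bdd n d) \<nu> \<longleftrightarrow> d dvd weight n \<nu>" for \<nu>
    by (auto simp: obdd_accepts_def mod_bdd_def)
  then show ?thesis
    unfolding OBDD_def using MOD_boolean_function is_obdd_mod_bdd width_mod_bdd assms
    by (auto simp: MOD_def intro!: exI[of _ "mod_bdd n d"])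
qed

section \<open>Lower bound: exchanging tails at a cut\<close>

lemma consistent_path_splice:
  assumes p: "consistent_path n D \<mu> p" and q: "consistent_path n D \<nu> q" and pq: "p k = q k"
    and lo: "\<And>j. j \<in> {1..n} \<Longrightarrow> j \<le> k \<Longrightarrow> \<rho> (var_order D j) = \<mu> (var_order D j)"
    and hi: "\<And>j. j \<in> {1..n} \<Longrightarrow> k < j \<Longrightarrow> \<rho> (var_order D j) = \<nu> (var_order D j)"
  shows "consistent_path n D \<rho> (\<lambda>j. if j \<le> k then p j else q j)"
  unfolding consistent_path_def
proof (intro conjI ballI)
  show "(if 0 \<le> k then p 0 else q 0) = source D"
    using p by (simp add: consistent_path_def)
  fix j assume j: "j \<in> {1..n}"
  then have e: "(p (j - 1), \<mu> (var_order D j), p j) \<in> edges D"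
      "(q (j - 1), \<nu> (var_order D j), q j) \<in> edges D"
    using p q unfolding consistent_path_def by blast+
  \<comment> \<open>At \<open>j = Suc k\<close> the edge comes from \<open>q\<close> but starts at
    the shared node \<open>p k = q k\<close>.\<close>
  consider "j \<le> k" | "j = Suc k" | "k < j - 1" by linarith
  then show "(if j - 1 \<le> k then p (j - 1) else q (j - 1), \<rho> (var_order D j),
      if j \<le> k then p j else q j) \<in> edges D"
    using e lo[OF j] hi[OF j] pq by cases auto
qed

text \<open>Reindexes the ones by reading position, because the cut refers to the order of
  reading.\<close>

lemma weight_permute:
  assumes "\<pi> permutes {1..n}"
  shows "weight n \<nu> = card {s \<in> {1..n}. \<nu> (\<pi> s)}"
proof -
  have "weight n \<nu> = (\<Sum>s=1..n. of_bool (\<nu> (\<pi> s)))"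
    unfolding weight_def using sum.permute[OF assms, of "\<lambda>i. of_bool (\<nu> i)"]
    unfolding o_def .
  also have "\<dots> = card {s \<in> {1..n}. \<nu> (\<pi> s)}"
    by (simp add: sum_of_bool_eq Int_def)
  finally show ?thesis .
qed

lemma MOD_notin_NOBDD:
  assumes d: "0 < d" and n: "2 * (d - 1) \<le> n"
  shows "MOD n d \<notin> NOBDD n (d - 1)"
proof
  assume "MOD n d \<in> NOBDD n (d - 1)"
  then obtain D :: "nat bdd" where D: "is_nobdd n D" and w: "width n D \<le> d - 1"
    and acc: "\<And>\<nu>. \<nu> \<in> cube n \<Longrightarrow> MOD n d \<nu> = nobdd_accepts n D \<nu>"
    unfolding NOBDD_def by auto
  \<comment> \<open>Up to \<open>d - 1\<close> ones must fit on each side of the cut; the bound on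
    \<open>n\<close> leaves at least \<open>d - 1\<close> positions after it.\<close>
  define k where "k = d - 1"
  have k: "k \<le> n" using n by (simp add: k_def)
  define \<pi> where "\<pi> = var_order D"
  have \<pi>: "\<pi> permutes {1..n}" using D by (simp add: is_nobdd_def \<pi>_def)
  \<comment> \<open>\<open>inv \<pi> t\<close> is the step that reads variable \<open>t\<close>. For
    \<open>i \<le> k\<close>, the part before the cut depends only on \<open>i\<close>, the part
    after it only on \<open>j\<close>. The outer \<open>mod d\<close> turns \<open>j = 0\<close>
    into 0 ones instead of \<open>d\<close>.\<close>
  define x where "x i j = (\<lambda>t\<in>{1..n}. let s = inv \<pi> t in
    s \<le> i \<or> k < s \<and> s \<le> k + (d - j) mod d)" for i j
  have x_cube: "x i j \<in> cube n" for i j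
    by (simp add: cube_def x_def)
  have x_eval: "x i j (\<pi> s) \<longleftrightarrow> s \<le> i \<or> k < s \<and> s \<le> k + (d - j) mod d"
    if "s \<in> {1..n}" for i j s
  proof -
    have "\<pi> s \<in> {1..n}" using that permutes_in_image[OF \<pi>] by blast
    then show ?thesis unfolding x_def by (simp add: permutes_inverses[OF \<pi>])
  qed
  have x_weight: "weight n (x i j) = i + (d - j) mod d" if "i < d" for i j
  proof -
    have "(d - j) mod d \<le> k" using d by (simp add: k_def less_Suc_eq_le[symmetric])
    moreover have "i \<le> k" using that by (simp add: k_def)
    ultimately have "{s \<in> {1..n}. x i j (\<pi> s)} = {1..i} \<union> {k<..k + (d - j) mod d}"
      using x_eval n k_def by auto
    moreover have "{1..i} \<inter> {k<..k + (d - j) mod d} = {}" using \<open>i \<le> k\<close> by auto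
    ultimately show ?thesis by (simp add: weight_permute[OF \<pi>] card_Un_disjoint)
  qed
  have x_acc: "nobdd_accepts n D (x i j) \<longleftrightarrow> i = j" if "i < d" "j < d" for i j
  proof -
    have "d dvd i + (d - j) mod d \<longleftrightarrow> i = j"
    proof (cases "j = 0")
      case True
      then show ?thesis using that d by (auto dest: dvd_imp_le)
    next
      case False
      \<comment> \<open>For \<open>0 < j\<close> the sum lies strictly between 0 and
        \<open>2 * d\<close>, so \<open>d\<close> is the only possible multiple.\<close>
      have "d dvd i + (d - j) \<longleftrightarrow> i = j"
      proof
        assume "d dvd i + (d - j)"
        then obtain c where c: "i + (d - j) = d * c" by blast
        moreover have "c = 1"
        proof -
          have "0 < d * c" "d * c < d * 2" using c that by linarith+
          then show ?thesis by simp
        qed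
        ultimately show "i = j" using that by simp
      qed (use that in simp)
      then show ?thesis using that False by simp
    qed
    then show ?thesis
      using acc[OF x_cube, of i j] x_weight[OF that(1), of j] x_cube by (simp add: MOD_def)
  qed
  have "\<exists>p. consistent_path n D (x i i) p \<and> p n \<in> accepting D" if "i < d" for i
    using x_acc[OF that that] by (simp add: nobdd_accepts_def)
  then obtain p where p: "\<And>i. i < d \<Longrightarrow> consistent_path n D (x i i) (p i)"
    and p_acc: "\<And>i. i < d \<Longrightarrow> p i n \<in> accepting D"
    by metis
  have "inj_on (\<lambda>i. p i k) {..<d}"
  proof (rule inj_onI)
    fix i j assume ij: "i \<in> {..<d}" "j \<in> {..<d}" and eq: "p i k = p j k"
    then have "i \<le> k" "j \<le> k" by (auto simp: k_def)
    \<comment> \<open>\<open>x i j\<close> agrees with \<open>x i i\<close> up to the cut and with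
      \<open>x j j\<close> after it.\<close>
    then have "consistent_path n D (x i j) (\<lambda>t. if t \<le> k then p i t else p j t)"
      using p ij eq x_eval
      by (intro consistent_path_splice[of n D "x i i" _ "x j j"]) (auto simp: \<pi>_def[symmetric])
    moreover have "(if n \<le> k then p i n else p j n) \<in> accepting D"
      using p_acc ij by auto
    ultimately have "nobdd_accepts n D (x i j)"
      unfolding nobdd_accepts_def by blast
    then show "i = j" using x_acc ij by simp
  qed
  moreover have "(\<lambda>i. p i k) ` {..<d} \<subseteq> level D k"
    using consistent_path_level[OF D p k] by auto
  moreover have "finite (level D k)"
    using D k by (simp add: is_nobdd_def)
  ultimately have "d \<le> card (level D k)"
    using card_inj_on_le by fastforce
  also have "\<dots> \<le> width n D"
    unfolding width_def using k by (intro Max_ge) auto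
  finally show False using w d by simp
qed

theorem theorem7:
  fixes n d :: nat
  assumes "1 < d" and "real d \<le> real n / 2"
  shows "OBDD n (d - 1) \<subset> OBDD n d \<and> NOBDD n (d - 1) \<subset> NOBDD n d"
proof -
  have "2 * d \<le> n" using assms(2) by linarith
  \<comment> \<open>By the inclusion of \<open>OBDD\<close> in \<open>NOBDD\<close>, these two facts
    witness strictness in both hierarchies.\<close>
  then have "MOD n d \<in> OBDD n d" "MOD n d \<notin> NOBDD n (d - 1)"
    using MOD_in_OBDD MOD_notin_NOBDD assms(1) by simp_all
  then show ?thesis
    using OBDD_subset_NOBDD[of n d] OBDD_subset_NOBDD[of n "d - 1"]
      OBDD_mono[of "d - 1" d n] NOBDD_mono[of "d - 1" d n] by auto
qed

end
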